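(* Let $X$ be a real Hilbert space and let $f,g,h$ be in $\Gamma_0(X)$ such that $P_f\preceq P_g$ and $P_g\preceq P_h$. Then $P_f\preceq P_h$.
   Context: $X$ is a real Hilbert space with inner product $\langle\cdot,\cdot\rangle$ and induced norm $\|\cdot\|$. $\Gamma_0(X)$ is the set of all convex, lower semicontinuous, proper functions $X\to\mathbb{R}\cup\{+\infty\}$. The proximal mapping of $f\in\Gamma_0(X)$ is $P_f=(\operatorname{Id}+\partial f)^{-1}\colon X\to X$, where $\partial f$ is the subdifferential. $\mathcal{F}(X)$ is the set of firmly nonexpansive mappings, i.e. $T\colon X\to X$ with $\|Tx-Ty\|^2\le\langle x-y,Tx-Ty\rangle$ for all $x,y\in X$; every proximal mapping belongs to $\mathcal{F}(X)$. The resolvent order on $\mathcal{F}(X)$ is $T_1\preceq T_2 :\Leftrightarrow T_2-T_1\in\mathcal{F}(X)$. *)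

theory Defs
  imports "HOL-Analysis.Analysis"
begin

definition convex_ereal :: "('a::real_vector \<Rightarrow> ereal) \<Rightarrow> bool" where
  "convex_ereal f \<longleftrightarrow>
     (\<forall>x y t. 0 < t \<longrightarrow> t < 1 \<longrightarrow>
        f ((1 - t) *\<^sub>R x + t *\<^sub>R y) \<le> ereal (1 - t) * f x + ereal t * f y)"

(* In ereal, - \<infinity> + \<infinity> = \<infinity>; no such sum arises in convex_ereal for a proper f. *)
definition proper :: "('a \<Rightarrow> ereal) \<Rightarrow> bool" where
  "proper f \<longleftrightarrow> (\<forall>x. f x \<noteq> - \<infinity>) \<and> (\<exists>x. f x \<noteq> \<infinity>)"

definition lower_semicontinuous :: "('a::topological_space \<Rightarrow> ereal) \<Rightarrow> bool" where
  "lower_semicontinuous f \<longleftrightarrow> (\<forall>x. f x \<le> Liminf (at x) f)"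

definition Gamma0 :: "('a::{real_inner, complete_space} \<Rightarrow> ereal) set" ("\<Gamma>\<^sub>0") where
  "\<Gamma>\<^sub>0 = {f. convex_ereal f \<and> lower_semicontinuous f \<and> proper f}"

(* For proper f the set is empty at points where f is \<infinity>. *)
definition subdifferential :: "('a::real_inner \<Rightarrow> ereal) \<Rightarrow> 'a \<Rightarrow> 'a set" where
  "subdifferential f x = {u. \<forall>y. ereal ((y - x) \<bullet> u) + f x \<le> f y}"

(* The set-valued inverse (Id + A)^{-1} of a set-valued operator A:
   p belongs to its value at x iff x belongs to p + A p. *)
definition resolvent :: "('a::ab_group_add \<Rightarrow> 'a set) \<Rightarrow> 'a \<Rightarrow> 'a set" where
  "resolvent A x = {p. \<exists>u\<in>A p. x = p + u}"

(* For f in \<Gamma>\<^sub>0 on a Hilbert space the resolvent of the subdifferential is everywhere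
   single-valued (Minty), so that the definite description denotes; for other f it may not. *)
definition prox :: "('a::{real_inner, complete_space} \<Rightarrow> ereal) \<Rightarrow> 'a \<Rightarrow> 'a" where
  "prox f x = (THE p. p \<in> resolvent (subdifferential f) x)"

definition firmly_nonexpansive :: "('a::real_inner \<Rightarrow> 'a) set" where
  "firmly_nonexpansive =
     {T. \<forall>x y. (norm (T x - T y))\<^sup>2 \<le> (x - y) \<bullet> (T x - T y)}"

(* The order of interest is the restriction of this relation to firmly_nonexpansive. *)
definition resolvent_le :: "('a::real_inner \<Rightarrow> 'a) \<Rightarrow> ('a \<Rightarrow> 'a) \<Rightarrow> bool" (infix "\<preceq>" 50) where
  "T\<^sub>1 \<preceq> T\<^sub>2 \<longleftrightarrow> (\<lambda>x. T\<^sub>2 x - T\<^sub>1 x) \<in> firmly_nonexpansive"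

end

theory Submission
  imports Defs
begin

text \<open>The operator $T = P_h - P_f$ is a sum of the firmly nonexpansive operators $P_g - P_f$ and
  $P_h - P_g$, hence monotone, and $\mathrm{Id} - T = (\mathrm{Id} - P_h) + P_f$ is a sum of
  monotone operators as well. For a symmetric linear $T$ this says $0 \le T \le \mathrm{Id}$, and
  then $T^2 \le T$, which is firm nonexpansiveness. The substitute for symmetry in the nonlinear
  case is that $T$ is a gradient: every proximal mapping $P_f$ is the gradient of
  $x \mapsto \langle x, P_f x\rangle - f(P_f x) - \frac{1}{2}\|P_f x\|^2$, the conjugate of
  $f + \frac{1}{2}\|\cdot\|^2$, and so $T$ is the gradient of a difference of two such functions.
  A gradient $T$ for which both $T$ and $\mathrm{Id} - T$ are monotone is firmly nonexpansive
  (\<open>firmly_nonexpansive_gradient\<close>, a form of the Baillon-Haddad theorem).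

  Since the proximal mapping is a definite description, the argument also rests on Minty's
  theorem for subdifferentials (\<open>Gamma0_resolvent_ex1\<close>): the function
  $f + \frac{1}{2}\|\cdot - x\|^2$ is bounded below and has a minimizer because minimizing
  sequences are Cauchy.\<close>

section \<open>Existence of proximal points\<close>

lemma Gamma0_finite:
  assumes "f \<in> \<Gamma>\<^sub>0" "f y \<noteq> \<infinity>"
  shows "f y = ereal (real_of_ereal (f y))"
  using assms by (cases "f y") (auto simp: Gamma0_def proper_def)

lemma Gamma0_convexD:
  assumes f: "f \<in> \<Gamma>\<^sub>0" and y: "f y \<noteq> \<infinity>" and z: "f z \<noteq> \<infinity>" and t: "0 < t" "t < 1"
  shows "f ((1 - t) *\<^sub>R y + t *\<^sub>R z) \<noteq> \<infinity>"
    and "real_of_ereal (f ((1 - t) *\<^sub>R y + t *\<^sub>R z))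
           \<le> (1 - t) * real_of_ereal (f y) + t * real_of_ereal (f z)"
proof -
  let ?w = "(1 - t) *\<^sub>R y + t *\<^sub>R z"
  have "f ?w \<le> ereal (1 - t) * f y + ereal t * f z"
    using f t unfolding Gamma0_def convex_ereal_def by blast
  also have "\<dots> = ereal ((1 - t) * real_of_ereal (f y) + t * real_of_ereal (f z))"
    by (subst Gamma0_finite[OF f y], subst Gamma0_finite[OF f z]) simp
  finally have le: "f ?w \<le> ereal ((1 - t) * real_of_ereal (f y) + t * real_of_ereal (f z))" .
  show fin: "f ?w \<noteq> \<infinity>"
    using le by auto
  show "real_of_ereal (f ?w) \<le> (1 - t) * real_of_ereal (f y) + t * real_of_ereal (f z)"
    using le by (subst (asm) Gamma0_finite[OF f fin]) simp
qed

text \<open>The hypothesis of lower semicontinuity is stated with punctured neighbourhoods; the point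
  itself may be added, since the inequality holds there anyway.\<close>

lemma lower_semicontinuous_eventually:
  assumes "lower_semicontinuous f" "c < f x"
  shows "eventually (\<lambda>y. c < f y) (nhds x)"
proof -
  have "c < Liminf (at x) f"
    using assms unfolding lower_semicontinuous_def by (meson less_le_trans)
  then have "eventually (\<lambda>y. c < f y) (at x)"
    by (rule less_LiminfD)
  then show ?thesis
    using assms(2) by (auto simp: eventually_at_filter elim: eventually_mono)
qed

text \<open>Lower semicontinuity bounds \<open>f\<close> below on a small ball around a point \<open>x0\<close> of its domain.
  By convexity, a value of \<open>f\<close> far away on a ray from \<open>x0\<close> cannot decrease faster than linearly
  without violating this bound where the ray leaves the ball. This weak form of
  an affine minorant suffices for coercivity and needs no separation theorem.\<close>

lemma Gamma0_linear_lower_bound: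
  fixes f :: "'a::{real_inner, complete_space} \<Rightarrow> ereal"
  assumes f: "f \<in> \<Gamma>\<^sub>0"
  obtains c K :: real and x0 :: 'a
  where "\<And>y. f y \<noteq> \<infinity> \<Longrightarrow> c - K * norm (y - x0) \<le> real_of_ereal (f y)"
proof -
  obtain x0 where x0: "f x0 \<noteq> \<infinity>"
    using f by (auto simp: Gamma0_def proper_def)
  let ?r = "\<lambda>y. real_of_ereal (f y)"
  have "ereal (?r x0 - 1) < f x0"
    by (subst (2) Gamma0_finite[OF f x0]) simp
  then have "eventually (\<lambda>y. ereal (?r x0 - 1) < f y) (nhds x0)"
    using f by (intro lower_semicontinuous_eventually) (auto simp: Gamma0_def)
  then obtain d where d: "d > 0" "\<And>y. dist y x0 < d \<Longrightarrow> ereal (?r x0 - 1) < f y"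
    by (auto simp: eventually_nhds_metric)
  define e where "e = d / 2"
  have e: "e > 0" and ball: "\<And>y. norm (y - x0) \<le> e \<Longrightarrow> f y \<noteq> \<infinity> \<Longrightarrow> ?r x0 - 1 < ?r y"
  proof -
    show "e > 0" using d by (simp add: e_def)
    fix y assume y: "norm (y - x0) \<le> e" "f y \<noteq> \<infinity>"
    then have "ereal (?r x0 - 1) < f y"
      using d by (intro d(2)) (simp add: dist_norm e_def)
    then show "?r x0 - 1 < ?r y"
      using Gamma0_finite[OF f y(2)] by (metis less_ereal.simps(1))
  qed
  have "?r x0 - 1 - 1 / e * norm (y - x0) \<le> ?r y" if y: "f y \<noteq> \<infinity>" for y
  proof (cases "norm (y - x0) \<le> e")
    case True
    then show ?thesis using ball[OF True y] e
      by (smt (verit) divide_nonneg_nonneg mult_nonneg_nonneg norm_ge_zero)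
  next
    case False
    define t where "t = e / norm (y - x0)"
    have pos: "norm (y - x0) > 0"
      using False e by linarith
    then have t: "0 < t" "t < 1"
      using False e by (simp_all add: t_def)
    let ?w = "(1 - t) *\<^sub>R x0 + t *\<^sub>R y"
    have "?w - x0 = t *\<^sub>R (y - x0)"
      by (simp add: algebra_simps)
    then have "norm (?w - x0) \<le> e"
      using pos e by (simp add: t_def)
    then have "?r x0 - 1 < ?r ?w"
      using ball Gamma0_convexD(1)[OF f x0 y t] by blast
    also have "\<dots> \<le> (1 - t) * ?r x0 + t * ?r y"
      by (rule Gamma0_convexD(2)[OF f x0 y t])
    finally have "t * ?r x0 - 1 < t * ?r y"
      by (simp add: algebra_simps)
    then have "?r x0 - 1 / t < ?r y"
      using t by (simp add: field_simps)
    then show ?thesis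
      using pos e by (simp add: t_def)
  qed
  then show thesis
    using that by blast
qed

text \<open>A minimizer of $f + \frac{1}{2}\|\cdot - x\|^2$: evaluating the functional at the midpoint of
  two almost minimal points and using the parallelogram law shows that these points are close,
  so a minimizing sequence converges, and lower semicontinuity identifies its limit.\<close>

lemma Gamma0_proximal_minimizer:
  fixes f :: "'a::{real_inner, complete_space} \<Rightarrow> ereal"
  assumes f: "f \<in> \<Gamma>\<^sub>0"
  obtains p where "f p \<noteq> \<infinity>"
    and "\<And>y. f y \<noteq> \<infinity> \<Longrightarrow> real_of_ereal (f p) + (norm (p - x))\<^sup>2 / 2
                             \<le> real_of_ereal (f y) + (norm (y - x))\<^sup>2 / 2"
proof -
  define r where "r = (\<lambda>y. real_of_ereal (f y))"
  define D where "D = {y. f y \<noteq> \<infinity>}"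
  define G where "G = (\<lambda>y. r y + (norm (y - x))\<^sup>2 / 2)"
  obtain c K x0 where low: "\<And>y. f y \<noteq> \<infinity> \<Longrightarrow> c - K * norm (y - x0) \<le> real_of_ereal (f y)"
    using Gamma0_linear_lower_bound[OF f] by metis
  have "c - \<bar>K\<bar> * norm (x - x0) - K\<^sup>2 / 2 \<le> G y" if "y \<in> D" for y
  proof -
    have "K * norm (y - x0) \<le> \<bar>K\<bar> * (norm (y - x) + norm (x - x0))"
      using norm_triangle_ineq[of "y - x" "x - x0"] by (intro mult_mono) auto
    (* Young's inequality: the quadratic term absorbs the linear decrease of f. *)
    moreover have "\<bar>K\<bar> * norm (y - x) \<le> K\<^sup>2 / 2 + (norm (y - x))\<^sup>2 / 2"
      using sum_squares_bound[of "\<bar>K\<bar>" "norm (y - x)"] by simp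
    ultimately show ?thesis
      using low[of y] that by (simp add: G_def r_def D_def algebra_simps)
  qed
  then have bdd: "bdd_below (G ` D)"
    by (intro bdd_belowI2)
  have ne: "D \<noteq> {}"
    using f by (auto simp: D_def Gamma0_def proper_def)
  define m where "m = Inf (G ` D)"
  have mle: "m \<le> G y" if "y \<in> D" for y
    unfolding m_def using that bdd by (intro cInf_lower) auto
  have "\<exists>y\<in>D. G y < m + 1 / real (Suc n)" for n
    using cInf_lessD[of "G ` D" "m + 1 / real (Suc n)"] ne by (auto simp: m_def)
  then obtain s where s: "\<And>n. s n \<in> D" "\<And>n. G (s n) < m + 1 / real (Suc n)"
    by metis
  have close: "(norm (y - z))\<^sup>2 \<le> 4 * (G y - m) + 4 * (G z - m)" if "y \<in> D" "z \<in> D" for y z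
  proof -
    let ?w = "(1 - 1/2) *\<^sub>R y + (1/2) *\<^sub>R z"
    have wD: "?w \<in> D" and "r ?w \<le> (1 - 1/2) * r y + (1/2) * r z"
      using Gamma0_convexD[OF f, of y z "1/2"] that by (auto simp: D_def r_def)
    moreover have "(norm (?w - x))\<^sup>2
        = (norm (y - x))\<^sup>2 / 2 + (norm (z - x))\<^sup>2 / 2 - (norm (y - z))\<^sup>2 / 4"
      by (simp add: power2_norm_eq_inner inner_diff_left inner_diff_right inner_add_left
          inner_add_right inner_commute field_simps)
    ultimately show ?thesis
      using mle[OF wD] unfolding G_def by argo
  qed
  have "Cauchy s"
  proof (rule metric_CauchyI)
    fix e :: real assume e: "e > 0"
    obtain N where N: "8 / e\<^sup>2 < real (Suc N)"
      using reals_Archimedean2 less_Suc_eq of_nat_less_iff by (metis less_trans lessI)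
    have "dist (s i) (s j) < e" if "i \<ge> N" "j \<ge> N" for i j
    proof -
      have gap: "G (s k) - m < 1 / real (Suc N)" if "k \<ge> N" for k
      proof -
        have "1 / real (Suc k) \<le> 1 / real (Suc N)"
          using that by (intro divide_left_mono) auto
        then show ?thesis using s(2)[of k] by linarith
      qed
      have "(norm (s i - s j))\<^sup>2 < 8 / real (Suc N)"
        using close[OF s(1)[of i] s(1)[of j]] gap[OF that(1)] gap[OF that(2)] by simp
      also have "\<dots> < e\<^sup>2"
        using N e by (simp add: field_simps)
      finally show ?thesis
        using e by (simp add: dist_norm power_less_imp_less_base)
    qed
    then show "\<exists>M. \<forall>i\<ge>M. \<forall>j\<ge>M. dist (s i) (s j) < e"
      by blast
  qed
  then obtain p where p: "s \<longlonglongrightarrow> p"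
    using Cauchy_convergent convergent_def by blast
  have Gs: "(\<lambda>n. G (s n)) \<longlonglongrightarrow> m"
  proof (rule tendsto_sandwich[where f = "\<lambda>_. m"])
    show "(\<lambda>n. m + 1 / real (Suc n)) \<longlonglongrightarrow> m"
      using tendsto_add[OF tendsto_const LIMSEQ_inverse_real_of_nat, of m]
      by (simp add: inverse_eq_divide)
    show "\<forall>\<^sub>F n in sequentially. G (s n) \<le> m + 1 / real (Suc n)"
      by (intro always_eventually allI less_imp_le s(2))
  qed (use mle s(1) in auto)
  have rs: "(\<lambda>n. r (s n)) \<longlonglongrightarrow> m - (norm (p - x))\<^sup>2 / 2"
  proof -
    have "(\<lambda>n. G (s n) - (norm (s n - x))\<^sup>2 / 2) \<longlonglongrightarrow> m - (norm (p - x))\<^sup>2 / 2"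
      by (intro tendsto_intros Gs p) auto
    then show ?thesis by (simp add: G_def)
  qed
  have fp: "f p \<le> ereal (m - (norm (p - x))\<^sup>2 / 2)"
  proof (rule ccontr)
    assume "\<not> ?thesis"
    then obtain b where b: "ereal (m - (norm (p - x))\<^sup>2 / 2) < ereal b" "ereal b < f p"
      using ereal_dense2 by (metis not_le)
    have "eventually (\<lambda>y. ereal b < f y) (nhds p)"
      using f b by (intro lower_semicontinuous_eventually) (auto simp: Gamma0_def)
    then have "eventually (\<lambda>n. ereal b < f (s n)) sequentially"
      using p by (rule eventually_compose_filterlim)
    moreover have "eventually (\<lambda>n. r (s n) < b) sequentially"
      using rs b(1) by (intro order_tendstoD) auto
    ultimately have "eventually (\<lambda>n. False) sequentially"
    proof eventually_elim
      case (elim n)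
      have "f (s n) = ereal (r (s n))"
        using Gamma0_finite[OF f, of "s n"] s(1)[of n] by (simp add: D_def r_def)
      then show ?case using elim by simp
    qed
    then show False by simp
  qed
  then have pD: "f p \<noteq> \<infinity>" by auto
  have "r p \<le> m - (norm (p - x))\<^sup>2 / 2"
    using fp by (subst (asm) Gamma0_finite[OF f pD]) (simp add: r_def)
  then have "G p \<le> m" by (simp add: G_def)
  then show thesis
    using that[OF pD] mle unfolding G_def r_def D_def by (force intro: order_trans)
qed

text \<open>Minty's theorem for subdifferentials. Existence is the first order condition for
  the minimizer \<open>p\<close>, obtained by comparing it with the points \<open>p + t (y - p)\<close> for \<open>t \<rightarrow> 0\<close>;
  uniqueness is monotonicity of the subdifferential.\<close>

lemma Gamma0_resolvent_ex1:
  fixes f :: "'a::{real_inner, complete_space} \<Rightarrow> ereal"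
  assumes f: "f \<in> \<Gamma>\<^sub>0"
  shows "\<exists>!p. f p \<noteq> \<infinity> \<and> (\<forall>y. ereal ((y - p) \<bullet> (x - p)) + f p \<le> f y)"
proof (rule ex_ex1I)
  let ?r = "\<lambda>y. real_of_ereal (f y)"
  obtain p where pD: "f p \<noteq> \<infinity>"
    and min: "\<And>y. f y \<noteq> \<infinity> \<Longrightarrow> ?r p + (norm (p - x))\<^sup>2 / 2 \<le> ?r y + (norm (y - x))\<^sup>2 / 2"
    using Gamma0_proximal_minimizer[OF f] by blast
  have "ereal ((y - p) \<bullet> (x - p)) + f p \<le> f y" for y
  proof (cases "f y = \<infinity>")
    case False
    have bound: "(y - p) \<bullet> (x - p) + ?r p - ?r y \<le> t * ((norm (y - p))\<^sup>2 / 2)"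
      if t: "0 < t" "t < 1" for t
    proof -
      let ?w = "(1 - t) *\<^sub>R p + t *\<^sub>R y"
      have "?r p + (norm (p - x))\<^sup>2 / 2 \<le> (1 - t) * ?r p + t * ?r y + (norm (?w - x))\<^sup>2 / 2"
        using min[OF Gamma0_convexD(1)[OF f pD False t]] Gamma0_convexD(2)[OF f pD False t]
        by linarith
      moreover have "?w - x = (p - x) + t *\<^sub>R (y - p)"
        by (simp add: algebra_simps)
      then have "(norm (?w - x))\<^sup>2
          = (norm (p - x))\<^sup>2 - 2 * t * ((y - p) \<bullet> (x - p)) + t\<^sup>2 * (norm (y - p))\<^sup>2"
        unfolding power2_norm_eq_inner
        by (simp add: inner_diff_left inner_diff_right inner_add_left
            inner_add_right inner_commute algebra_simps power2_eq_square)
      ultimately have "t * ((y - p) \<bullet> (x - p) + ?r p - ?r y) \<le> t * (t * ((norm (y - p))\<^sup>2 / 2))"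
        by (simp add: algebra_simps power2_eq_square)
      then show ?thesis
        using t by simp
    qed
    have "((\<lambda>t. t * ((norm (y - p))\<^sup>2 / 2)) \<longlongrightarrow> 0 * ((norm (y - p))\<^sup>2 / 2)) (at_right 0)"
      by (intro tendsto_intros)
    moreover have "eventually (\<lambda>t. (y - p) \<bullet> (x - p) + ?r p - ?r y \<le> t * ((norm (y - p))\<^sup>2 / 2))
        (at_right (0::real))"
      using bound by (auto simp: eventually_at_right_field intro!: exI[of _ 1])
    ultimately have "(y - p) \<bullet> (x - p) + ?r p - ?r y \<le> 0 * ((norm (y - p))\<^sup>2 / 2)"
      by (intro tendsto_lowerbound[where F = "at_right (0::real)"]) auto
    then show ?thesis
      by (subst Gamma0_finite[OF f pD], subst Gamma0_finite[OF f False]) simp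
  qed simp
  with pD show "\<exists>p. f p \<noteq> \<infinity> \<and> (\<forall>y. ereal ((y - p) \<bullet> (x - p)) + f p \<le> f y)"
    by blast
next
  let ?r = "\<lambda>y. real_of_ereal (f y)"
  fix p q
  assume p: "f p \<noteq> \<infinity> \<and> (\<forall>y. ereal ((y - p) \<bullet> (x - p)) + f p \<le> f y)"
    and q: "f q \<noteq> \<infinity> \<and> (\<forall>y. ereal ((y - q) \<bullet> (x - q)) + f q \<le> f y)"
  have fin: "f p = ereal (?r p)" "f q = ereal (?r q)"
    using p q Gamma0_finite[OF f] by auto
  have "(q - p) \<bullet> (x - p) + ?r p \<le> ?r q"
    using p[THEN conjunct2, rule_format, of q] fin
    by (metis ereal_less_eq(3) plus_ereal.simps(1))
  moreover have "(p - q) \<bullet> (x - q) + ?r q \<le> ?r p"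
    using q[THEN conjunct2, rule_format, of p] fin
    by (metis ereal_less_eq(3) plus_ereal.simps(1))
  ultimately have "(p - q) \<bullet> (p - q) \<le> 0"
    by (simp add: inner_diff_left inner_diff_right inner_commute)
  then show "p = q"
    by (simp flip: power2_norm_eq_inner)
qed

section \<open>Proximal mappings as gradients\<close>

lemma prox_char:
  assumes f: "f \<in> \<Gamma>\<^sub>0"
  shows "f (prox f x) \<noteq> \<infinity> \<and>
    (\<forall>y. ereal ((y - prox f x) \<bullet> (x - prox f x)) + f (prox f x) \<le> f y)"
proof -
  have "p \<in> resolvent (subdifferential f) x \<longleftrightarrow>
      f p \<noteq> \<infinity> \<and> (\<forall>y. ereal ((y - p) \<bullet> (x - p)) + f p \<le> f y)" for p
  proof -
    have eq: "(\<exists>u\<in>A. x = p + u) \<longleftrightarrow> x - p \<in> A" for A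
      by (metis add_diff_cancel_left' add.commute diff_add_cancel)
    obtain y where "f y \<noteq> \<infinity>"
      using f by (auto simp: Gamma0_def proper_def)
    then have fin: "f p \<noteq> \<infinity>" if "\<forall>y. ereal ((y - p) \<bullet> (x - p)) + f p \<le> f y"
      using that[rule_format, of y] by auto
    show ?thesis
      unfolding resolvent_def subdifferential_def mem_Collect_eq
      unfolding eq[of "{u. \<forall>y. ereal ((y - p) \<bullet> u) + f p \<le> f y}"]
      using fin by blast
  qed
  then show ?thesis
    unfolding prox_def using theI'[OF Gamma0_resolvent_ex1[OF f]] by simp
qed

lemma prox_finite:
  assumes "f \<in> \<Gamma>\<^sub>0"
  shows "f (prox f x) = ereal (real_of_ereal (f (prox f x)))"
  using Gamma0_finite prox_char assms by blast

lemma prox_subgradient: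
  assumes f: "f \<in> \<Gamma>\<^sub>0"
  shows "(prox f y - prox f x) \<bullet> (x - prox f x) + real_of_ereal (f (prox f x))
           \<le> real_of_ereal (f (prox f y))"
proof -
  have "ereal ((prox f y - prox f x) \<bullet> (x - prox f x)) + f (prox f x) \<le> f (prox f y)"
    using prox_char[OF f] by blast
  then show ?thesis
    by (metis prox_finite[OF f] ereal_less_eq(3) plus_ereal.simps(1))
qed

lemma prox_firmly_nonexpansive:
  assumes f: "f \<in> \<Gamma>\<^sub>0"
  shows "prox f \<in> firmly_nonexpansive"
  unfolding firmly_nonexpansive_def mem_Collect_eq
proof (intro allI)
  fix x y
  show "(norm (prox f x - prox f y))\<^sup>2 \<le> (x - y) \<bullet> (prox f x - prox f y)"
    using prox_subgradient[OF f, of y x] prox_subgradient[OF f, of x y]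
    by (simp add: power2_norm_eq_inner inner_diff_left inner_diff_right inner_commute)
qed

lemma firmly_nonexpansive_monotone:
  assumes "T \<in> firmly_nonexpansive"
  shows "0 \<le> (x - y) \<bullet> (T x - T y)"
  using assms unfolding firmly_nonexpansive_def mem_Collect_eq
  by (meson order_trans zero_le_power2)

lemma firmly_nonexpansive_norm_le:
  assumes "T \<in> firmly_nonexpansive"
  shows "norm (T x - T y) \<le> norm (x - y)"
proof -
  have "(norm (T x - T y))\<^sup>2 \<le> (x - y) \<bullet> (T x - T y)"
    using assms unfolding firmly_nonexpansive_def mem_Collect_eq by blast
  also have "\<dots> \<le> norm (x - y) * norm (T x - T y)"
    by (rule norm_cauchy_schwarz)
  finally show ?thesis
    by (cases "norm (T x - T y) = 0") (auto simp: power2_eq_square)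
qed

text \<open>The conjugate of $f + \frac{1}{2}\|\cdot\|^2$, expressed through the point where the supremum
  that defines it is attained.\<close>

definition prox_potential :: "('a::{real_inner, complete_space} \<Rightarrow> ereal) \<Rightarrow> 'a \<Rightarrow> real" where
  "prox_potential f x =
     x \<bullet> prox f x - real_of_ereal (f (prox f x)) - (norm (prox f x))\<^sup>2 / 2"

lemma prox_potential_subgradient:
  assumes f: "f \<in> \<Gamma>\<^sub>0"
  shows "prox_potential f x + (y - x) \<bullet> prox f x \<le> prox_potential f y"
proof -
  have "0 \<le> (norm (prox f x - prox f y))\<^sup>2 / 2"
    by simp
  then show ?thesis
    using prox_subgradient[OF f, of x y] unfolding prox_potential_def
    by (simp add: power2_norm_eq_inner inner_diff_left inner_diff_right inner_commute
        field_simps)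
qed

text \<open>The subgradient inequalities at \<open>x\<close> and at a nearby point enclose the increment of the
  potential, and the width of this enclosure is of second order because the proximal mapping is
  nonexpansive.\<close>

lemma prox_potential_has_derivative:
  assumes f: "f \<in> \<Gamma>\<^sub>0"
  shows "(prox_potential f has_derivative (\<lambda>d. d \<bullet> prox f x)) (at x)"
proof (rule has_derivativeI_sandwich[where e = 1 and H = "\<lambda>y. norm (y - x)"])
  show "bounded_linear (\<lambda>d. d \<bullet> prox f x)"
    by (rule bounded_linear_inner_left)
  fix y assume "y \<noteq> x"
  have "prox_potential f y - prox_potential f x - (y - x) \<bullet> prox f x
      \<le> (y - x) \<bullet> (prox f y - prox f x)"
    using prox_potential_subgradient[OF f, of y x]
    by (simp add: inner_diff_left inner_diff_right)
  also have "\<dots> \<le> norm (y - x) * norm (prox f y - prox f x)"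
    by (rule norm_cauchy_schwarz)
  also have "\<dots> \<le> norm (y - x) * norm (y - x)"
    by (intro mult_left_mono firmly_nonexpansive_norm_le prox_firmly_nonexpansive f) simp
  finally show "norm (prox_potential f y - prox_potential f x - (y - x) \<bullet> prox f x) / norm (y - x)
      \<le> norm (y - x)"
    using prox_potential_subgradient[OF f, of x y] \<open>y \<noteq> x\<close>
    by (simp add: divide_le_eq)
next
  have "((\<lambda>y. norm (y - x)) \<longlongrightarrow> norm (x - x)) (at x)"
    by (intro tendsto_intros)
  then show "((\<lambda>y. norm (y - x)) \<longlongrightarrow> 0) (at x)"
    by simp
qed auto

section \<open>Gradients between zero and the identity\<close>

lemma monotone_gradient_inequality:
  fixes T :: "'a::real_inner \<Rightarrow> 'a"
  assumes deriv: "\<And>x. (\<phi> has_derivative (\<lambda>d. d \<bullet> T x)) (at x)"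
    and mono: "\<And>x y. 0 \<le> (x - y) \<bullet> (T x - T y)"
  shows "\<phi> x + (y - x) \<bullet> T x \<le> \<phi> y"
proof -
  let ?l = "\<lambda>t::real. x + t *\<^sub>R (y - x)"
  have "((\<lambda>t. \<phi> (?l t)) has_real_derivative (y - x) \<bullet> T (?l t)) (at t)" for t
  proof -
    have "(?l has_derivative (\<lambda>s. s *\<^sub>R (y - x))) (at t)"
      by (auto intro!: derivative_eq_intros)
    from has_derivative_compose[OF this deriv]
    show ?thesis
      by (simp add: has_field_derivative_def mult.commute[of _ "(y - x) \<bullet> T (?l t)"])
  qed
  then obtain t where t: "0 < t" "\<phi> (?l 1) - \<phi> (?l 0) = (1 - 0) * ((y - x) \<bullet> T (?l t))"
    using MVT2[of 0 1 "\<lambda>t. \<phi> (?l t)" "\<lambda>t. (y - x) \<bullet> T (?l t)"] by auto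
  have "0 \<le> t * ((y - x) \<bullet> (T (?l t) - T x))"
    using mono[of "?l t" x] by simp
  then have "(y - x) \<bullet> T x \<le> (y - x) \<bullet> T (?l t)"
    using t(1) by (simp add: zero_le_mult_iff inner_diff_right)
  then show ?thesis
    using t(2) by simp
qed

text \<open>Both \<open>\<phi>\<close> and $\frac{1}{2}\|\cdot\|^2 - \phi$ are convex, so that \<open>\<phi>\<close> lies above its tangents
  but at most $\frac{1}{2}\|\cdot\|^2$ above them. A gradient step from \<open>y\<close> for the function \<open>\<phi>\<close> minus
  its tangent at \<open>x\<close>, which is nonnegative, shows that \<open>\<phi>\<close> exceeds this tangent at \<open>y\<close> by at
  least $\frac{1}{2}\|T x - T y\|^2$. Adding this to the same estimate with \<open>x\<close> and \<open>y\<close> exchanged is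
  firm nonexpansiveness.\<close>

lemma firmly_nonexpansive_gradient:
  fixes T :: "'a::real_inner \<Rightarrow> 'a"
  assumes deriv: "\<And>x. (\<phi> has_derivative (\<lambda>d. d \<bullet> T x)) (at x)"
    and mono: "\<And>x y. 0 \<le> (x - y) \<bullet> (T x - T y)"
    and mono': "\<And>x y. 0 \<le> (x - y) \<bullet> ((x - T x) - (y - T y))"
  shows "T \<in> firmly_nonexpansive"
proof -
  have lower: "\<phi> x + (y - x) \<bullet> T x \<le> \<phi> y" for x y
    using deriv mono by (rule monotone_gradient_inequality)
  have "((\<lambda>x. x \<bullet> x / 2 - \<phi> x) has_derivative (\<lambda>d. d \<bullet> (x - T x))) (at x)" for x
    by (auto intro!: derivative_eq_intros deriv simp: inner_diff_right inner_commute)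
  from monotone_gradient_inequality[OF this mono']
  have upper: "\<phi> y \<le> \<phi> x + (y - x) \<bullet> T x + (norm (y - x))\<^sup>2 / 2" for x y
    by (smt (verit) power2_norm_eq_inner inner_diff_left inner_diff_right inner_commute
        field_sum_of_halves)
  have "\<phi> x + (y - x) \<bullet> T x + (norm (T x - T y))\<^sup>2 / 2 \<le> \<phi> y" for x y
    using lower[of x "y - (T y - T x)"] upper[where x = y and y = "y - (T y - T x)"]
    by (simp add: power2_norm_eq_inner inner_diff_left inner_diff_right inner_add_left
        inner_add_right inner_commute field_simps)
  from this[of x y for x y] this[of y x for x y]
  show ?thesis
    unfolding firmly_nonexpansive_def mem_Collect_eq
    by (smt (verit) norm_minus_commute inner_diff_left inner_diff_right field_sum_of_halves)
qed

section \<open>Transitivity of the resolvent order on proximal mappings\<close>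

theorem theorem3p6:
  fixes f g h :: "'a::{real_inner, complete_space} \<Rightarrow> ereal"
  assumes "f \<in> \<Gamma>\<^sub>0" and "g \<in> \<Gamma>\<^sub>0" and "h \<in> \<Gamma>\<^sub>0"
    and "prox f \<preceq> prox g" and "prox g \<preceq> prox h"
  shows "prox f \<preceq> prox h"
  unfolding resolvent_le_def
proof (rule firmly_nonexpansive_gradient)
  fix x y
  show "((\<lambda>x. prox_potential h x - prox_potential f x) has_derivative
      (\<lambda>d. d \<bullet> (prox h x - prox f x))) (at x)"
    unfolding inner_diff_right
    by (intro has_derivative_diff prox_potential_has_derivative assms)
  show "0 \<le> (x - y) \<bullet> ((prox h x - prox f x) - (prox h y - prox f y))"
    using firmly_nonexpansive_monotone[OF assms(4)[unfolded resolvent_le_def], of x y]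
      firmly_nonexpansive_monotone[OF assms(5)[unfolded resolvent_le_def], of x y]
    by (simp add: inner_diff_right)
  have "(x - y) \<bullet> (prox h x - prox h y) \<le> norm (x - y) * norm (prox h x - prox h y)"
    by (rule norm_cauchy_schwarz)
  also have "\<dots> \<le> norm (x - y) * norm (x - y)"
    by (intro mult_left_mono firmly_nonexpansive_norm_le prox_firmly_nonexpansive assms) simp
  also have "\<dots> = (x - y) \<bullet> (x - y)"
    by (simp add: power2_norm_eq_inner flip: power2_eq_square)
  finally show "0 \<le> (x - y) \<bullet> ((x - (prox h x - prox f x)) - (y - (prox h y - prox f y)))"
    using firmly_nonexpansive_monotone[OF prox_firmly_nonexpansive[OF assms(1)], of x y]
    by (simp add: inner_diff_right)
qed

end
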